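(* For every $n\ge 2$, the code $\mathcal C_n$ is locally perfect.
   Context: A code is a subset $\mathcal C\subseteq 2^{[N]}$. $\Delta(\mathcal C)$ is the smallest simplicial complex containing $\mathcal C$. For a simplicial complex $\Delta$ and $\sigma\in\Delta$, $\mathrm{link}_\Delta(\sigma)=\{\tau\mid\tau\cap\sigma=\emptyset,\ \tau\cup\sigma\in\Delta\}$. $M(\mathcal C)$ is the set of maximal codewords and $\widehat{M(\mathcal C)}$ the set of all intersections of nonempty families of maximal codewords. A simplicial complex on a finite vertex set $V$ is convex union representable if it equals the nerve $\{\tau\subseteq V\mid\bigcap_{v\in\tau}U_v\neq\emptyset\}$ of some collection $\{U_v\}_{v\in V}$ of convex open sets in some $\mathbb R^d$ whose union $\bigcup_v U_v$ is convex. $\mathcal C$ has a nerve obstruction at $\sigma\in\widehat{M(\mathcal C)}\setminus\mathcal C$ if $\mathrm{link}_{\Delta(\mathcal C)}(\sigma)$ is not convex union representable; $\mathcal C$ is locally perfect if it has no nerve obstructions. For $n\ge2$, $\mathcal C_n\subseteq 2^{[2n+2]}$ is the code consisting of: (i) $\emptyset$; (ii) $\sigma\cup\{n+1\}$ for every nonempty proper subset $\sigma\subsetneq[n]$; (iii) $\{n+1+i\}$ for $1\le i\le n+1$; (iv) $([n]\setminus\{i\})\cup\{n+1\}\cup\{n+1+i\}$ for $1\le i\le n$; (v) $[n]\cup\{n+1\}\cup\{2n+2\}$; (vi) $\{n+2,n+3,\ldots,2n+2\}$. *)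

theory Defs
  imports "HOL-Analysis.Analysis"
begin

section \<open>Simplicial complexes\<close>

definition abstract_complex :: "'a set set \<Rightarrow> bool" where
  "abstract_complex K \<longleftrightarrow> (\<forall>\<sigma>\<in>K. finite \<sigma> \<and> (\<forall>\<tau>. \<tau> \<subseteq> \<sigma> \<longrightarrow> \<tau> \<in> K))"

definition link :: "'a set set \<Rightarrow> 'a set \<Rightarrow> 'a set set" where
  "link K \<sigma> = {\<tau>. \<tau> \<inter> \<sigma> = {} \<and> \<tau> \<union> \<sigma> \<in> K}"

(* The empty set is always a face of the nerve: the intersection over the empty family is UNIV,
   which is nonempty just as the ambient space R^d is. *)
definition nerve :: "'v set \<Rightarrow> ('v \<Rightarrow> 'b set) \<Rightarrow> 'v set set" where
  "nerve V U = {\<tau>. \<tau> \<subseteq> V \<and> (\<Inter>v\<in>\<tau>. U v) \<noteq> {}}"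

section \<open>Convex union representability\<close>

(* The dimension d is existentially quantified below, so R^d cannot be a type indexed by d. It is
   the library's Euclidean_space d: sequences vanishing from index d on, with the product topology.
   Since nat => real is not an instance of real_vector, the library's convex does not apply; the
   next definition is its defining formula with coordinatewise operations. *)
definition convex_seq :: "(nat \<Rightarrow> real) set \<Rightarrow> bool" where
  "convex_seq S \<longleftrightarrow>
     (\<forall>x\<in>S. \<forall>y\<in>S. \<forall>u\<ge>0. \<forall>v\<ge>0. u + v = 1 \<longrightarrow> (\<lambda>i. u * x i + v * y i) \<in> S)"

definition convex_union_representable :: "'v set \<Rightarrow> 'v set set \<Rightarrow> bool" where
  "convex_union_representable V K \<longleftrightarrow>
     finite V \<and> abstract_complex K \<and>
     (\<exists>(d::nat) (U :: 'v \<Rightarrow> (nat \<Rightarrow> real) set).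
        (\<forall>v\<in>V. openin (Euclidean_space d) (U v) \<and> convex_seq (U v)) \<and>
        convex_seq (\<Union>v\<in>V. U v) \<and>
        K = nerve V U)"

lemma convex_union_representableI:
  fixes U :: "'v \<Rightarrow> (nat \<Rightarrow> real) set"
  assumes "finite V" "abstract_complex K"
    and "\<forall>v\<in>V. openin (Euclidean_space d) (U v) \<and> convex_seq (U v)"
    and "convex_seq (\<Union>v\<in>V. U v)" "K = nerve V U"
  shows "convex_union_representable V K"
  unfolding convex_union_representable_def
  by (intro conjI exI) (rule assms)+

(* Elements of the ground set that are not vertices of K are represented by empty sets, so the
   choice of the ground set does not matter. *)
lemma convex_union_representable_ground_set:
  assumes "finite W" "\<Union>K \<subseteq> W"
  shows "convex_union_representable W K \<longleftrightarrow> convex_union_representable (\<Union>K) K"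
proof
  assume "convex_union_representable W K"
  then obtain d :: nat and U :: "'a \<Rightarrow> (nat \<Rightarrow> real) set"
    where K: "abstract_complex K"
      and U: "\<forall>v\<in>W. openin (Euclidean_space d) (U v) \<and> convex_seq (U v)"
             "convex_seq (\<Union>v\<in>W. U v)" "K = nerve W U"
    unfolding convex_union_representable_def by (elim conjE exE) (rule that)
  have empty: "U v = {}" if "v \<in> W" "v \<notin> \<Union>K" for v
  proof (rule ccontr)
    assume "U v \<noteq> {}"
    with that have "{v} \<in> K" using U(3) by (auto simp: nerve_def)
    with that show False by auto
  qed
  show "convex_union_representable (\<Union>K) K"
  proof (rule convex_union_representableI)
    show "finite (\<Union>K)" by (rule finite_subset[OF assms(2,1)])
    show "\<forall>v\<in>\<Union>K. openin (Euclidean_space d) (U v) \<and> convex_seq (U v)"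
      using U(1) assms(2) by blast
    have "(\<Union>v\<in>\<Union>K. U v) = (\<Union>v\<in>W. U v)" using empty assms(2) by blast
    with U(2) show "convex_seq (\<Union>v\<in>\<Union>K. U v)" by simp
    have "\<tau> \<in> K \<longleftrightarrow> \<tau> \<in> nerve (\<Union>K) U" for \<tau>
    proof -
      have "\<tau> \<in> K \<longleftrightarrow> \<tau> \<subseteq> W \<and> (\<Inter>v\<in>\<tau>. U v) \<noteq> {}"
        by (subst U(3)) (simp add: nerve_def)
      moreover have "\<tau> \<subseteq> \<Union>K" if "\<tau> \<in> K" using that by blast
      ultimately show ?thesis using assms(2) by (auto simp: nerve_def)
    qed
    then show "K = nerve (\<Union>K) U" by blast
  qed (rule K)
next
  assume "convex_union_representable (\<Union>K) K"
  then obtain d :: nat and U :: "'a \<Rightarrow> (nat \<Rightarrow> real) set"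
    where K: "abstract_complex K"
      and U: "\<forall>v\<in>\<Union>K. openin (Euclidean_space d) (U v) \<and> convex_seq (U v)"
             "convex_seq (\<Union>v\<in>\<Union>K. U v)" "K = nerve (\<Union>K) U"
    unfolding convex_union_representable_def by (elim conjE exE) (rule that)
  define U' where "U' = (\<lambda>v. if v \<in> \<Union>K then U v else {})"
  show "convex_union_representable W K"
  proof (rule convex_union_representableI)
    show "\<forall>v\<in>W. openin (Euclidean_space d) (U' v) \<and> convex_seq (U' v)"
      using U(1) by (auto simp: U'_def convex_seq_def)
    have "(\<Union>v\<in>W. U' v) = (\<Union>v\<in>\<Union>K. U v)"
      using assms(2) unfolding U'_def by (auto split: if_splits)
    with U(2) show "convex_seq (\<Union>v\<in>W. U' v)" by simp
    have "\<tau> \<in> K \<longleftrightarrow> \<tau> \<in> nerve W U'" for \<tau>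
    proof (cases "\<tau> \<subseteq> \<Union>K")
      case True
      have "\<tau> \<in> K \<longleftrightarrow> \<tau> \<subseteq> \<Union>K \<and> (\<Inter>v\<in>\<tau>. U v) \<noteq> {}"
        by (subst U(3)) (simp add: nerve_def)
      moreover have "(\<Inter>v\<in>\<tau>. U' v) = (\<Inter>v\<in>\<tau>. U v)"
        using True unfolding U'_def by (intro INF_cong) auto
      ultimately show ?thesis using True assms(2) by (simp add: nerve_def subset_trans)
    next
      case False
      then obtain v where "v \<in> \<tau>" "v \<notin> \<Union>K" by blast
      then have "(\<Inter>v\<in>\<tau>. U' v) = {}" unfolding U'_def by auto
      with False show ?thesis by (auto simp: nerve_def)
    qed
    then show "K = nerve W U'" by blast
  qed (rule assms(1) K)+
qed

section \<open>Codes\<close>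

definition maximal_codewords :: "'a set set \<Rightarrow> 'a set set" where
  "maximal_codewords C = {c \<in> C. \<forall>c'\<in>C. c \<subseteq> c' \<longrightarrow> c' = c}"

definition intersections :: "'a set set \<Rightarrow> 'a set set" where
  "intersections M = {\<Inter>F | F. F \<subseteq> M \<and> F \<noteq> {}}"

(* \<open>abstract_complex hull C\<close> is the smallest simplicial complex containing C. *)
definition nerve_obstruction :: "'a set set \<Rightarrow> 'a set \<Rightarrow> bool" where
  "nerve_obstruction C \<sigma> \<longleftrightarrow>
     \<sigma> \<in> intersections (maximal_codewords C) - C \<and>
     (let L = link (abstract_complex hull C) \<sigma>
      in \<not> convex_union_representable (\<Union>L) L)"

definition locally_perfect :: "'a set set \<Rightarrow> bool" where
  "locally_perfect C \<longleftrightarrow> \<not> (\<exists>\<sigma>. nerve_obstruction C \<sigma>)"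

lemma abstract_complex_hull:
  assumes "\<forall>c\<in>C. finite c"
  shows "abstract_complex hull C = {\<tau>. \<exists>c\<in>C. \<tau> \<subseteq> c}"
proof (rule hull_unique)
  show "abstract_complex {\<tau>. \<exists>c\<in>C. \<tau> \<subseteq> c}"
    using assms by (auto simp: abstract_complex_def intro: finite_subset)
qed (auto simp: abstract_complex_def)

definition code_C :: "nat \<Rightarrow> nat set set" where
  "code_C n =
     {{}} \<union>
     {\<sigma> \<union> {n + 1} | \<sigma>. \<sigma> \<noteq> {} \<and> \<sigma> \<subset> {1..n}} \<union>
     {{n + 1 + i} | i. 1 \<le> i \<and> i \<le> n + 1} \<union>
     {({1..n} - {i}) \<union> {n + 1} \<union> {n + 1 + i} | i. 1 \<le> i \<and> i \<le> n} \<union>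
     {{1..n} \<union> {n + 1} \<union> {2 * n + 2}} \<union>
     {{n + 2..2 * n + 2}}"

lemma code_C_subset: "code_C n \<subseteq> Pow {1..2 * n + 2}"
  by (auto simp: code_C_def)

end

theory Submission
  imports Defs
begin

text \<open>Every intersection of maximal codewords outside the code equals \<open>{n + 1}\<close>. Its link is the
  simplex on \<open>{1..n} \<union> {2 * n + 2}\<close> together with a cone, with apex \<open>n + 1 + i\<close>, over each facet
  \<open>{1..n} - {i}\<close> of the simplex on \<open>{1..n}\<close>. In the open half-space where
  \<open>x\<^sub>1 + \<dots> + x\<^sub>n > 0\<close> represent the vertex \<open>i\<close> by \<open>x\<^sub>i > 0\<close>, the vertex \<open>2 * n + 2\<close> by the orthant
  where all coordinates are positive, and the apex \<open>n + 1 + i\<close> by the orthant where exactly \<open>x\<^sub>i\<close> is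
  negative. The half-spaces \<open>x\<^sub>i > 0\<close> already cover, since a positive sum has a positive summand.\<close>

section \<open>Convex open orthants in the half-space of positive coordinate sum\<close>

lemma convex_seq_Int:
  assumes "convex_seq S" "convex_seq T"
  shows "convex_seq (S \<inter> T)"
  using assms unfolding convex_seq_def by blast

lemma convex_seq_topspace_Euclidean_space:
  "convex_seq (topspace (Euclidean_space d))"
  by (auto simp: convex_seq_def topspace_Euclidean_space)

lemma convex_combination_pos:
  fixes a b u v :: real
  assumes "a > 0" "b > 0" "u \<ge> 0" "v \<ge> 0" "u + v = 1"
  shows "u * a + v * b > 0"
proof (cases "u = 0")
  case False
  with assms have "u * a > 0" "v * b \<ge> 0" by auto
  then show ?thesis by linarith
qed (use assms in auto)

lemma convex_seq_linear_pos:
  assumes "\<And>x y u v. f (\<lambda>i. u * x i + v * y i) = u * f x + v * (f y :: real)"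
  shows "convex_seq {x. f x > 0}"
  by (auto simp: convex_seq_def assms convex_combination_pos)

lemma continuous_map_Euclidean_space_component:
  "continuous_map (Euclidean_space d) euclideanreal (\<lambda>x. x k)"
  unfolding Euclidean_space_def
  by (intro continuous_map_from_subtopology continuous_map_product_projection) simp

lemma openin_Euclidean_space_pos:
  assumes "continuous_map (Euclidean_space d) euclideanreal f"
  shows "openin (Euclidean_space d) (topspace (Euclidean_space d) \<inter> {x. f x > 0})"
  using openin_continuous_map_preimage[OF assms, of "{0<..}"]
  by (simp add: Int_def)

text \<open>Coordinate 0 of the ambient space \<open>Euclidean_space (n + 1)\<close> is a dummy, so that the
  coordinates in use are indexed by \<open>{1..n}\<close>.\<close>

definition orthant :: "nat \<Rightarrow> nat set \<Rightarrow> nat set \<Rightarrow> (nat \<Rightarrow> real) set" where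
  "orthant n P N = {x \<in> topspace (Euclidean_space (n + 1)).
     (\<Sum>j=1..n. x j) > 0 \<and> (\<forall>j\<in>P. x j > 0) \<and> (\<forall>j\<in>N. - x j > 0)}"

text \<open>Convexity can now be checked one linear inequality at a time. Negativity is written
  \<open>- x j > 0\<close> so that every factor has the form \<open>f x > 0\<close> with
  \<open>f\<close> linear.\<close>

lemma orthant_eq_Inter:
  "orthant n P N = topspace (Euclidean_space (n + 1)) \<inter>
     \<Inter>(insert {x. (\<Sum>j=1..n. x j) > 0} ((\<lambda>j. {x. x j > 0}) ` P \<union> (\<lambda>j. {x. - x j > 0}) ` N))"
  by (auto simp: orthant_def)

lemma convex_seq_orthant: "convex_seq (orthant n P N)"
proof -
  have Inter: "convex_seq (\<Inter>\<S>)" if "\<And>S. S \<in> \<S> \<Longrightarrow> convex_seq S" for \<S> :: "(nat \<Rightarrow> real) set set"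
    using that unfolding convex_seq_def by blast
  show ?thesis
    unfolding orthant_eq_Inter
  proof (intro convex_seq_Int convex_seq_topspace_Euclidean_space Inter)
    fix S :: "(nat \<Rightarrow> real) set"
    assume "S \<in> insert {x. (\<Sum>j=1..n. x j) > 0}
      ((\<lambda>j. {x. x j > 0}) ` P \<union> (\<lambda>j. {x. - x j > 0}) ` N)"
    then consider "S = {x. (\<Sum>j=1..n. x j) > 0}" | j where "S = {x. x j > 0}"
      | j where "S = {x. - x j > 0}"
      by blast
    then show "convex_seq S"
      by cases (simp only:, rule convex_seq_linear_pos,
          simp add: sum.distrib sum_distrib_left algebra_simps)+
  qed
qed

lemma openin_orthant:
  assumes "finite P" "finite N"
  shows "openin (Euclidean_space (n + 1)) (orthant n P N)"
proof -
  let ?E = "Euclidean_space (n + 1)"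
  let ?H = "\<lambda>f. topspace ?E \<inter> {x :: nat \<Rightarrow> real. f x > (0 :: real)}"
  \<comment> \<open>Here the ambient space is intersected into each factor, so each factor is itself
    open and the family is finite and nonempty.\<close>
  have eq: "orthant n P N = \<Inter>(insert (?H (\<lambda>x. \<Sum>j=1..n. x j))
      ((\<lambda>j. ?H (\<lambda>x. x j)) ` P \<union> (\<lambda>j. ?H (\<lambda>x. - x j)) ` N))"
    by (auto simp: orthant_def)
  have "openin ?E (?H (\<lambda>x. \<Sum>j=1..n. x j))" "openin ?E (?H (\<lambda>x. x j))"
    "openin ?E (?H (\<lambda>x. - x j))" for j
    by (intro openin_Euclidean_space_pos continuous_map_sum continuous_map_minus
        continuous_map_Euclidean_space_component finite_atLeastAtMost)+
  then show ?thesis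
    unfolding eq by (intro openin_Inter) (use assms in auto)
qed

section \<open>The link as the nerve of a cover by orthants\<close>

definition link_complex :: "nat \<Rightarrow> nat set set" where
  "link_complex n = {\<tau>. \<tau> \<subseteq> {1..n} \<union> {2 * n + 2} \<or>
     (\<exists>i\<in>{1..n}. \<tau> \<subseteq> ({1..n} - {i}) \<union> {n + 1 + i})}"

lemma Union_link_complex: "\<Union>(link_complex n) \<subseteq> {1..n} \<union> {n + 2..2 * n + 2}"
  by (fastforce simp: link_complex_def)

lemma abstract_complex_link_complex: "abstract_complex (link_complex n)"
  unfolding abstract_complex_def
proof (intro ballI conjI allI impI)
  fix \<sigma> assume "\<sigma> \<in> link_complex n"
  then have "\<sigma> \<subseteq> {1..n} \<union> {n + 2..2 * n + 2}" using Union_link_complex by blast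
  then show "finite \<sigma>" by (rule finite_subset) simp
  fix \<tau> assume "\<tau> \<subseteq> \<sigma>"
  with \<open>\<sigma> \<in> link_complex n\<close> show "\<tau> \<in> link_complex n"
    unfolding link_complex_def by blast
qed

text \<open>In the last branch \<open>v - (n + 1)\<close> recovers the index \<open>i\<close> of the
  apex \<open>n + 1 + i\<close>. On the ground set used below this branch only sees \<open>v\<close>
  from \<open>n + 2\<close> to \<open>2 * n + 1\<close>, so the subtraction is never
  truncated.\<close>

definition link_cover :: "nat \<Rightarrow> nat \<Rightarrow> (nat \<Rightarrow> real) set" where
  "link_cover n v =
     (if v \<le> n then orthant n {v} {}
      else if v = 2 * n + 2 then orthant n {1..n} {}
      else orthant n ({1..n} - {v - (n + 1)}) {v - (n + 1)})"

lemma Union_link_cover: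
  "(\<Union>v\<in>{1..n} \<union> {n + 2..2 * n + 2}. link_cover n v) = orthant n {} {}"
proof
  show "(\<Union>v\<in>{1..n} \<union> {n + 2..2 * n + 2}. link_cover n v) \<subseteq> orthant n {} {}"
    by (auto simp: link_cover_def orthant_def split: if_splits)
  show "orthant n {} {} \<subseteq> (\<Union>v\<in>{1..n} \<union> {n + 2..2 * n + 2}. link_cover n v)"
  proof
    fix x assume x: "x \<in> orthant n {} {}"
    have "\<exists>j\<in>{1..n}. x j > 0"
    proof (rule ccontr)
      assume "\<not> ?thesis"
      then have "(\<Sum>j=1..n. x j) \<le> 0" by (intro sum_nonpos) (simp add: not_less)
      with x show False by (simp add: orthant_def)
    qed
    then obtain j where "j \<in> {1..n}" "x j > 0" by blast
    with x have "x \<in> link_cover n j" by (simp add: link_cover_def orthant_def)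
    with \<open>j \<in> {1..n}\<close> show "x \<in> (\<Union>v\<in>{1..n} \<union> {n + 2..2 * n + 2}. link_cover n v)" by blast
  qed
qed

text \<open>If a common point lies in the orthant of the apex \<open>n + 1 + i\<close>, then its
  coordinate \<open>i\<close> is its only negative one. This excludes the vertices \<open>i\<close>
  and \<open>2 * n + 2\<close>, where that coordinate is positive, and every other apex. Without an
  apex only the simplex on \<open>{1..n}\<close> and \<open>2 * n + 2\<close> remains.\<close>

lemma nerve_link_cover_subset:
  "nerve ({1..n} \<union> {n + 2..2 * n + 2}) (link_cover n) \<subseteq> link_complex n"
proof
  fix \<tau> assume "\<tau> \<in> nerve ({1..n} \<union> {n + 2..2 * n + 2}) (link_cover n)"
  then obtain x where \<tau>: "\<tau> \<subseteq> {1..n} \<union> {n + 2..2 * n + 2}"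
    and x: "\<And>v. v \<in> \<tau> \<Longrightarrow> x \<in> link_cover n v"
    by (auto simp: nerve_def)
  have pos: "x v > 0" if "v \<in> \<tau>" "v \<le> n" for v
    using x[OF that(1)] that(2) by (simp add: link_cover_def orthant_def)
  have neg: "x i < 0 \<and> (\<forall>j\<in>{1..n} - {i}. x j > 0)"
    if "n + 1 + i \<in> \<tau>" "i \<in> {1..n}" for i
    using x[OF that(1)] that(2) by (simp add: link_cover_def orthant_def)
  show "\<tau> \<in> link_complex n"
  proof (cases "\<exists>i\<in>{1..n}. n + 1 + i \<in> \<tau>")
    case True
    then obtain i where i: "i \<in> {1..n}" "n + 1 + i \<in> \<tau>" by blast
    have "v \<in> ({1..n} - {i}) \<union> {n + 1 + i}" if v: "v \<in> \<tau>" for v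
    proof (cases "v \<le> n")
      case True
      have "v \<noteq> i" using pos[OF v True] neg[OF i(2,1)] by auto
      with True v \<tau> show ?thesis by auto
    next
      case False
      with v \<tau> have v': "n + 2 \<le> v" "v \<le> 2 * n + 2" by auto
      have "v \<noteq> 2 * n + 2"
      proof
        assume "v = 2 * n + 2"
        with x[OF v] i have "x i > 0" by (simp add: link_cover_def orthant_def)
        with neg[OF i(2,1)] show False by simp
      qed
      with v' have k: "v - (n + 1) \<in> {1..n}" "n + 1 + (v - (n + 1)) = v" by auto
      with v have "x (v - (n + 1)) < 0" using neg[OF _ k(1)] by simp
      with neg[OF i(2,1)] k(1) have "v - (n + 1) = i" by (meson DiffI less_asym singletonD)
      with k show ?thesis by auto
    qed
    with i show ?thesis unfolding link_complex_def by blast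
  next
    case False
    have "v \<in> {1..n} \<union> {2 * n + 2}" if "v \<in> \<tau>" for v
    proof (rule ccontr)
      assume "v \<notin> {1..n} \<union> {2 * n + 2}"
      with that \<tau> have "v - (n + 1) \<in> {1..n}" "n + 1 + (v - (n + 1)) = v" by force+
      with that False show False by metis
    qed
    then show ?thesis unfolding link_complex_def by blast
  qed
qed

lemma link_complex_subset_nerve:
  assumes "n \<ge> 2"
  shows "link_complex n \<subseteq> nerve ({1..n} \<union> {n + 2..2 * n + 2}) (link_cover n)"
proof
  fix \<tau> assume \<tau>: "\<tau> \<in> link_complex n"
  then have sub: "\<tau> \<subseteq> {1..n} \<union> {n + 2..2 * n + 2}" using Union_link_complex by blast
  have "\<exists>x. \<forall>v\<in>\<tau>. x \<in> link_cover n v"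
  proof (cases "\<tau> \<subseteq> {1..n} \<union> {2 * n + 2}")
    case True
    \<comment> \<open>The value 0 outside \<open>{1..n}\<close> keeps the point in the ambient
      Euclidean space.\<close>
    define x where "x = (\<lambda>j. if j \<in> {1..n} then 1 else 0 :: real)"
    have "x \<in> orthant n {1..n} {}"
      using assms by (auto simp: orthant_def x_def topspace_Euclidean_space)
    then have "x \<in> link_cover n v" if "v \<in> \<tau>" for v
      using that True by (auto simp: link_cover_def orthant_def)
    then show ?thesis by blast
  next
    case False
    with \<tau> have "\<exists>i\<in>{1..n}. \<tau> \<subseteq> ({1..n} - {i}) \<union> {n + 1 + i}"
      by (simp only: link_complex_def mem_Collect_eq simp_thms)
    then obtain i where i: "i \<in> {1..n}" "\<tau> \<subseteq> ({1..n} - {i}) \<union> {n + 1 + i}" by blast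
    \<comment> \<open>The coordinate sum is \<open>n - 3/2\<close>, which is positive exactly
      because \<open>n \<ge> 2\<close>.\<close>
    define x where "x = (\<lambda>j. if j = i then - (1 / 2) else if j \<in> {1..n} then 1 else 0 :: real)"
    have "(\<Sum>j=1..n. x j) = x i + (\<Sum>j\<in>{1..n} - {i}. x j)"
      using i by (intro sum.remove) auto
    also have "(\<Sum>j\<in>{1..n} - {i}. x j) = (\<Sum>j\<in>{1..n} - {i}. 1)"
      by (intro sum.cong) (auto simp: x_def)
    also have "\<dots> = real n - 1" using i assms by (simp add: of_nat_diff)
    finally have "(\<Sum>j=1..n. x j) > 0" using assms by (simp add: x_def)
    then have "x \<in> orthant n ({1..n} - {i}) {i}"
      using i by (auto simp: orthant_def topspace_Euclidean_space x_def)
    then have "x \<in> link_cover n v" if "v \<in> \<tau>" for v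
      using that i by (auto simp: link_cover_def orthant_def)
    then show ?thesis by blast
  qed
  with sub show "\<tau> \<in> nerve ({1..n} \<union> {n + 2..2 * n + 2}) (link_cover n)"
    by (auto simp: nerve_def)
qed

lemma convex_union_representable_link_complex:
  assumes "n \<ge> 2"
  shows "convex_union_representable (\<Union>(link_complex n)) (link_complex n)"
proof -
  \<comment> \<open>The cover is indexed by a set known to contain the vertices; a change of ground
    set then passes to the vertices themselves.\<close>
  let ?W = "{1..n} \<union> {n + 2..2 * n + 2}"
  have "convex_union_representable ?W (link_complex n)"
  proof (rule convex_union_representableI)
    show "\<forall>v\<in>?W. openin (Euclidean_space (n + 1)) (link_cover n v) \<and> convex_seq (link_cover n v)"
      unfolding link_cover_def
      by (auto intro: openin_orthant[simplified] convex_seq_orthant)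
    show "convex_seq (\<Union>v\<in>?W. link_cover n v)"
      unfolding Union_link_cover by (rule convex_seq_orthant)
    show "link_complex n = nerve ?W (link_cover n)"
      using nerve_link_cover_subset link_complex_subset_nerve[OF assms] by (rule equalityI[rotated])
  qed (simp_all add: abstract_complex_link_complex)
  then show ?thesis
    using convex_union_representable_ground_set[OF _ Union_link_complex] by simp
qed

section \<open>Maximal codewords, their intersections, and the link at
  \<open>{n + 1}\<close>\<close>

definition facet :: "nat \<Rightarrow> nat \<Rightarrow> nat set" where
  "facet n i = ({1..n} - {i}) \<union> {n + 1} \<union> {n + 1 + i}"

text \<open>For \<open>i = n + 1\<close> nothing is removed from \<open>{1..n}\<close>, so one
  formula covers both kinds of large codewords through \<open>n + 1\<close>.\<close>

lemma facet_last: "facet n (n + 1) = {1..n} \<union> {n + 1} \<union> {2 * n + 2}"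
  by (auto simp: facet_def)

lemma facet_in_code_C:
  assumes "i \<in> {1..n + 1}"
  shows "facet n i \<in> code_C n"
proof (cases "i = n + 1")
  case True
  then show ?thesis unfolding True facet_last code_C_def by blast
next
  case False
  with assms have "1 \<le> i \<and> i \<le> n" by auto
  then show ?thesis unfolding facet_def code_C_def by blast
qed

text \<open>The words \<open>\<sigma> \<union> {n + 1}\<close> extend to the last facet; the empty
  word and the singletons lie in \<open>{n + 2..2 * n + 2}\<close>. This controls both the maximal
  codewords and the simplicial complex of the code.\<close>

lemma code_C_cases:
  assumes "c \<in> code_C n" "n \<ge> 1"
  obtains i where "i \<in> {1..n + 1}" "c \<subseteq> facet n i"
  | "c \<subseteq> {n + 2..2 * n + 2}"
proof -
  consider "c = {}" | \<sigma> where "c = \<sigma> \<union> {n + 1}" "\<sigma> \<subset> {1..n}"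
    | i where "c = {n + 1 + i}" "1 \<le> i" "i \<le> n + 1"
    | i where "c = facet n i" "1 \<le> i" "i \<le> n"
    | "c = facet n (n + 1)" | "c = {n + 2..2 * n + 2}"
    using assms(1) unfolding code_C_def facet_last unfolding facet_def by blast
  then show thesis
  proof cases
    case 2
    then have "c \<subseteq> facet n (n + 1)" unfolding facet_last by blast
    then show thesis using that(1)[of "n + 1"] by simp
  next
    case 4
    then show thesis using that(1)[of i] by simp
  next
    case 5
    then show thesis using that(1)[of "n + 1"] by simp
  qed (use that(2) in auto)
qed

lemma maximal_codewords_code_C:
  assumes "n \<ge> 1"
  shows "maximal_codewords (code_C n) \<subseteq> facet n ` {1..n + 1} \<union> {{n + 2..2 * n + 2}}"
proof
  fix c assume "c \<in> maximal_codewords (code_C n)"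
  then have c: "c \<in> code_C n" and max: "\<And>c'. c' \<in> code_C n \<Longrightarrow> c \<subseteq> c' \<Longrightarrow> c' = c"
    by (auto simp: maximal_codewords_def)
  have top: "{n + 2..2 * n + 2} \<in> code_C n" by (simp add: code_C_def)
  from c assms show "c \<in> facet n ` {1..n + 1} \<union> {{n + 2..2 * n + 2}}"
  proof (cases rule: code_C_cases)
    case (1 i)
    with max[OF facet_in_code_C] show ?thesis by blast
  next
    case 2
    with max[OF top] show ?thesis by simp
  qed
qed

text \<open>One maximal codeword alone is in the code, so at least two are intersected. If
  \<open>{n + 2..2 * n + 2}\<close> is among them, the result is empty or a singleton codeword.
  Otherwise it is \<open>n + 1\<close> together with a proper subset of \<open>{1..n}\<close>, a
  codeword unless that subset is empty.\<close>

lemma intersection_notin_code_C: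
  assumes "n \<ge> 1" "\<sigma> \<in> intersections (maximal_codewords (code_C n))" "\<sigma> \<notin> code_C n"
  shows "\<sigma> = {n + 1}"
proof -
  let ?G = "{n + 2..2 * n + 2}"
  obtain F where F: "F \<subseteq> maximal_codewords (code_C n)" "F \<noteq> {}" "\<sigma> = \<Inter>F"
    using assms(2) by (auto simp: intersections_def)
  have shape: "c = ?G \<or> (\<exists>i\<in>{1..n + 1}. c = facet n i)" if "c \<in> F" for c
    using that F(1) maximal_codewords_code_C[OF assms(1)] by blast
  have notF: "\<sigma> \<noteq> c" if "c \<in> F" for c
    using that F(1) assms(3) by (auto simp: maximal_codewords_def)
  have proper: "\<exists>c'\<in>F. c' \<noteq> c" if "c \<in> F" for c
  proof (rule ccontr)
    assume "\<not> ?thesis"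
    with that F(3) have "\<sigma> = c" by blast
    with notF[OF that] show False by simp
  qed
  have noG: "?G \<notin> F"
  proof
    assume G: "?G \<in> F"
    then obtain c where c: "c \<in> F" "c \<noteq> ?G" using proper by blast
    then obtain i where i: "i \<in> {1..n + 1}" "c = facet n i" using shape by blast
    have "\<sigma> \<subseteq> ?G \<inter> c" using F(3) G c by blast
    also have "\<dots> \<subseteq> {n + 1 + i}" by (auto simp: i(2) facet_def)
    finally have "\<sigma> = {} \<or> \<sigma> = {n + 1 + i}" by blast
    with i(1) have "\<sigma> \<in> code_C n" by (auto simp: code_C_def)
    with assms(3) show False by blast
  qed
  then have shape': "\<exists>i\<in>{1..n + 1}. c = facet n i" if "c \<in> F" for c
    using shape that by blast
  obtain c where c: "c \<in> F" using F(2) by blast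
  obtain c' where c': "c' \<in> F" "c' \<noteq> c" using proper[OF c] by blast
  obtain i where i: "i \<in> {1..n + 1}" "c = facet n i" using shape'[OF c] by blast
  obtain j where j: "j \<in> {1..n + 1}" "c' = facet n j" using shape'[OF c'(1)] by blast
  have "i \<noteq> j" using c' i j by blast
  have in_\<sigma>: "n + 1 \<in> \<sigma>" using F(3) shape' by (auto simp: facet_def)
  have sub: "\<sigma> \<subseteq> facet n i \<inter> facet n j" using F(3) c c' i j by blast
  also have "\<dots> \<subseteq> ({1..n} - {i, j}) \<union> {n + 1}"
    using \<open>i \<noteq> j\<close> i(1) j(1) by (auto simp: facet_def)
  finally have sub: "\<sigma> \<subseteq> ({1..n} - {i, j}) \<union> {n + 1}" .
  \<comment> \<open>At most one of the two indices is \<open>n + 1\<close>, so some element of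
    \<open>{1..n}\<close> is missing from the intersection.\<close>
  have "i \<in> {1..n} \<or> j \<in> {1..n}" using \<open>i \<noteq> j\<close> i(1) j(1) by auto
  with sub have psub: "\<sigma> - {n + 1} \<subset> {1..n}" by blast
  have eq: "\<sigma> = (\<sigma> - {n + 1}) \<union> {n + 1}" using in_\<sigma> by blast
  have "\<sigma> - {n + 1} = {}"
  proof (rule ccontr)
    assume "\<sigma> - {n + 1} \<noteq> {}"
    with psub eq have "\<sigma> \<in> code_C n" unfolding code_C_def by blast
    with assms(3) show False by blast
  qed
  with in_\<sigma> show ?thesis by blast
qed

text \<open>The faces through \<open>n + 1\<close> are those inside some \<open>facet n i\<close>,
  and deleting \<open>n + 1\<close> from the facets gives the simplices that generate
  \<open>link_complex n\<close>.\<close>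

lemma link_code_C:
  assumes "n \<ge> 1"
  shows "link (abstract_complex hull (code_C n)) {n + 1} = link_complex n"
proof -
  have "finite c" if "c \<in> code_C n" for c
    using that code_C_subset[of n] by (meson PowD finite_atLeastAtMost finite_subset subsetD)
  then have hull: "abstract_complex hull (code_C n) = {\<tau>. \<exists>c\<in>code_C n. \<tau> \<subseteq> c}"
    by (intro abstract_complex_hull) blast
  have link_complex: "\<tau> \<in> link_complex n \<longleftrightarrow> (\<exists>i\<in>{1..n + 1}. \<tau> \<subseteq> facet n i - {n + 1})" for \<tau>
  proof -
    have "{1..n + 1} = insert (n + 1) {1..n}" by auto
    moreover have "facet n i - {n + 1} = ({1..n} - {i}) \<union> {n + 1 + i}" if "i \<in> {1..n}" for i
      using that by (auto simp: facet_def)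
    moreover have "facet n (n + 1) - {n + 1} = {1..n} \<union> {2 * n + 2}"
      unfolding facet_last by auto
    ultimately show ?thesis by (simp add: link_complex_def)
  qed
  show ?thesis
  proof (intro set_eqI iffI)
    fix \<tau> assume "\<tau> \<in> link (abstract_complex hull (code_C n)) {n + 1}"
    then obtain c where "n + 1 \<notin> \<tau>" and c: "c \<in> code_C n" "\<tau> \<union> {n + 1} \<subseteq> c"
      unfolding link_def hull by blast
    from c(1) assms show "\<tau> \<in> link_complex n"
    proof (cases rule: code_C_cases)
      case (1 i)
      with \<open>n + 1 \<notin> \<tau>\<close> c(2) show ?thesis unfolding link_complex by blast
    next
      case 2
      \<comment> \<open>This case is impossible: \<open>c\<close> contains \<open>n + 1\<close>,
        which is below \<open>n + 2\<close>.\<close>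
      with c(2) show ?thesis by auto
    qed
  next
    fix \<tau> assume "\<tau> \<in> link_complex n"
    then obtain i where "i \<in> {1..n + 1}" "\<tau> \<subseteq> facet n i - {n + 1}"
      unfolding link_complex by blast
    moreover have "n + 1 \<in> facet n i" by (simp add: facet_def)
    ultimately show "\<tau> \<in> link (abstract_complex hull (code_C n)) {n + 1}"
      unfolding link_def hull using facet_in_code_C by blast
  qed
qed

theorem theorem4p3:
  fixes n :: nat
  assumes "n \<ge> 2"
  shows "locally_perfect (code_C n)"
  unfolding locally_perfect_def
proof
  assume "\<exists>\<sigma>. nerve_obstruction (code_C n) \<sigma>"
  then obtain \<sigma> where \<sigma>: "\<sigma> \<in> intersections (maximal_codewords (code_C n))" "\<sigma> \<notin> code_C n"
    and obstruction: "\<not> convex_union_representable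
      (\<Union>(link (abstract_complex hull code_C n) \<sigma>)) (link (abstract_complex hull code_C n) \<sigma>)"
    by (auto simp: nerve_obstruction_def Let_def)
  have "\<sigma> = {n + 1}" using assms \<sigma> by (intro intersection_notin_code_C) auto
  with obstruction have "\<not> convex_union_representable (\<Union>(link_complex n)) (link_complex n)"
    using link_code_C assms by simp
  with convex_union_representable_link_complex[OF assms] show False by simp
qed

end
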